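(* Let $\mathbb{K}$ be a field and let $T=(t_{ijk}) \in \mathbb{K}^{m\times m\times m}$. Let $J_1$ be the $m^2\times m^2$ matrix with rows indexed by pairs $(i,j)$ and columns indexed by pairs $(u,v)$, $1\le i,j,u,v\le m$, whose entries are $$J_1((i,j),(u,v)) = \delta_{ui}\, t_{vj1} + \delta_{uj}\, t_{iv1} + \delta_{u1}\, t_{ijv},$$ where $\delta$ is the Kronecker delta. If $J_1$ is invertible, then the stabilizer of $T$ under the congruence action by $\mathrm{GL}(m,\mathbb{K})$ is finite.
   Context: A matrix $X=(x_{ij}) \in \mathrm{GL}(m,\mathbb{K})$ acts on $T \in \mathbb{K}^{m\times m\times m}$ by congruence, $T\mapsto [\![T;X,X,X]\!]$, where $[\![T;X,X,X]\!]_{ijk} = \sum_{\alpha,\beta,\gamma=1}^m t_{\alpha\beta\gamma}\,x_{i\alpha}x_{j\beta}x_{k\gamma}$. The stabilizer of $T$ is $\{X\in\mathrm{GL}(m,\mathbb{K}) : [\![T;X,X,X]\!]=T\}$. (In the paper $\mathbb{K}$ is usually $\mathbb{R}$ or $\mathbb{C}$.) *)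

theory Defs
  imports "HOL-Analysis.Cartesian_Space"
begin

text \<open>
  The index set \<open>{1,\<dots>,m}\<close> is a finite linearly ordered type \<open>'m\<close> with \<open>m = CARD('m)\<close>.
  The tensor entry \<open>t\<^sub>i\<^sub>j\<^sub>k\<close> is \<open>T $ i $ j $ k\<close>.
\<close>

type_synonym ('a, 'm) tensor3 = "'a ^ 'm ^ 'm ^ 'm"

text \<open>
  The index 1 is the least element of \<open>'m\<close>. It is not the numeral \<open>1 :: 'm\<close>, which is
  not the least element of a numeral type with more than one element.
\<close>

definition first_index :: "'m::{finite,linorder}" where
  "first_index = Min UNIV"

definition congruence :: "('a::field, 'm::finite) tensor3 \<Rightarrow> 'a ^ 'm ^ 'm \<Rightarrow> ('a, 'm) tensor3" where
  "congruence T X = (\<chi> i j k. \<Sum>\<alpha>\<in>UNIV. \<Sum>\<beta>\<in>UNIV. \<Sum>\<gamma>\<in>UNIV.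
     T $ \<alpha> $ \<beta> $ \<gamma> * X $ i $ \<alpha> * X $ j $ \<beta> * X $ k $ \<gamma>)"

definition stabilizer :: "('a::field, 'm::finite) tensor3 \<Rightarrow> ('a ^ 'm ^ 'm) set" where
  "stabilizer T = {X. invertible X \<and> congruence T X = T}"

definition kronecker :: "'m \<Rightarrow> 'm \<Rightarrow> 'a::zero_neq_one" where
  "kronecker i j = (if i = j then 1 else 0)"

definition J1 :: "('a::field, 'm::{finite,linorder}) tensor3 \<Rightarrow> 'a ^ ('m \<times> 'm) ^ ('m \<times> 'm)" where
  "J1 T = (\<chi> r c. case r of (i, j) \<Rightarrow> case c of (u, v) \<Rightarrow>
       kronecker u i * T $ v $ j $ first_index
     + kronecker u j * T $ i $ v $ first_index
     + kronecker u first_index * T $ i $ j $ v)"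

end

theory Submission
  imports Defs "HOL-Computational_Algebra.Formal_Power_Series"
    "HOL-Computational_Algebra.Polynomial" "HOL-Library.Function_Algebras"
begin

text \<open>
  Put \<open>F\<^sub>i\<^sub>j(X) = [T;X,X,X]\<^sub>i\<^sub>j\<^sub>1\<close>. If \<open>A\<close> stabilizes \<open>T\<close>, then \<open>F(\<Phi>A) = F(\<Phi>)\<close> for every matrix
  \<open>\<Phi>\<close> over a commutative \<open>K\<close>-algebra. The linear part of \<open>F\<close> at the identity is \<open>J\<^sub>1\<close>, so when
  \<open>J\<^sub>1\<close> is invertible there is, for any given bound \<open>D\<close>, a matrix \<open>\<Phi>\<close> over \<open>K[[s]]\<close> with
  \<open>\<Phi>(0) = I\<close> for which the \<open>m\<^sup>2\<close> series \<open>F\<^sub>i\<^sub>j(\<Phi>) - t\<^sub>i\<^sub>j\<^sub>1\<close> have orders so independent that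
  they satisfy no polynomial relation of degree at most \<open>D\<close> in each variable. By dimension
  counting, each entry of a generic \<open>m \<times> m\<close> matrix \<open>Z\<close> satisfies a polynomial relation with
  the \<open>m\<^sup>2\<close> polynomials \<open>F\<^sub>i\<^sub>j(Z)\<close>. Hence each entry of a matrix \<open>Z\<close> over \<open>K[[s]]\<close> with
  \<open>F(Z) = F(\<Phi>)\<close> is a root of a fixed nonzero polynomial, so there are finitely many such \<open>Z\<close>,
  and \<open>A\<close> is the constant term of \<open>Z = \<Phi>A\<close>. This works in every characteristic.
\<close>

text \<open>The vectors are indexed because products of polynomials with different exponents may
  coincide as functions. A repeated vector already gives a relation, with coefficients 1 and
  -1.\<close>

lemma (in vector_space) family_dependent_of_card:
  assumes I: "finite I" and B: "finite B" and v: "v ` I \<subseteq> span B" and card: "card B < card I"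
  shows "\<exists>q. (\<exists>i\<in>I. q i \<noteq> 0) \<and> (\<Sum>i\<in>I. scale (q i) (v i)) = 0"
proof (cases "inj_on v I")
  case True
  have "dependent (v ` I)"
  proof (rule ccontr)
    assume "\<not> dependent (v ` I)"
    with independent_span_bound[OF B _ v] have "card (v ` I) \<le> card B" by blast
    with card card_image[OF True] show False by simp
  qed
  then obtain u where u: "\<exists>w\<in>v ` I. u w \<noteq> 0" "(\<Sum>w\<in>v ` I. scale (u w) w) = 0"
    using dependent_finite I by auto
  then show ?thesis
    by (intro exI[of _ "u \<circ> v"]) (auto simp: sum.reindex[OF True])
next
  case False
  then obtain i j where ij: "i \<in> I" "j \<in> I" "i \<noteq> j" "v i = v j"
    by (auto simp: inj_on_def)
  define q where "q = (\<lambda>k. if k = i then 1 else if k = j then - 1 else 0 :: 'a)"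
  have "(\<Sum>k\<in>I. scale (q k) (v k)) = (\<Sum>k\<in>{i, j}. scale (q k) (v k))"
    using ij I by (intro sum.mono_neutral_right) (auto simp: q_def)
  also have "\<dots> = 0"
    using ij by (simp add: q_def)
  finally show ?thesis
    using ij by (intro exI[of _ q]) (auto simp: q_def intro!: bexI[of _ i])
qed

subsection \<open>Polynomial functions over a power series ring\<close>

text \<open>Scalars act through constant series, so dimensions are counted over the field
  \<open>'a\<close> and the relations obtained have coefficients in \<open>'a\<close>.\<close>

interpretation fps_fun: vector_space "\<lambda>(c::'a::field) (f::'b \<Rightarrow> 'a fps) x. fps_const c * f x"
  by unfold_locales
    (auto simp: fun_eq_iff algebra_simps simp flip: fps_const_mult fps_const_add)

definition exponents_le :: "nat \<Rightarrow> ('c \<Rightarrow> nat) set" where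
  "exponents_le d = {\<gamma>. \<forall>c. \<gamma> c \<le> d}"

lemma exponents_le_eq_PiE: "exponents_le d = PiE UNIV (\<lambda>_. {..d})"
  by (auto simp: exponents_le_def)

lemma finite_exponents_le: "finite (exponents_le d :: ('c::finite \<Rightarrow> nat) set)"
  by (simp add: exponents_le_eq_PiE finite_PiE)

lemma card_exponents_le: "card (exponents_le d :: ('c::finite \<Rightarrow> nat) set) = (d + 1) ^ CARD('c)"
  by (simp add: exponents_le_eq_PiE card_PiE)

definition monomial_fun :: "('c::finite \<Rightarrow> nat) \<Rightarrow> ('c \<Rightarrow> 'a::field fps) \<Rightarrow> 'a fps" where
  "monomial_fun \<gamma> z = (\<Prod>c\<in>UNIV. z c ^ \<gamma> c)"

text \<open>Here \<open>d\<close> bounds the degree in each variable separately, not the total degree.\<close>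

definition poly_funs :: "nat \<Rightarrow> (('c::finite \<Rightarrow> 'a::field fps) \<Rightarrow> 'a fps) set" where
  "poly_funs d = fps_fun.span (monomial_fun ` exponents_le d)"

lemma poly_funs_add: "f \<in> poly_funs d \<Longrightarrow> g \<in> poly_funs d \<Longrightarrow> (\<lambda>z. f z + g z) \<in> poly_funs d"
  using fps_fun.span_add[of f _ g] by (simp add: poly_funs_def plus_fun_def)

lemma poly_funs_diff: "f \<in> poly_funs d \<Longrightarrow> g \<in> poly_funs d \<Longrightarrow> (\<lambda>z. f z - g z) \<in> poly_funs d"
  using fps_fun.span_diff[of f _ g] by (simp add: poly_funs_def fun_diff_def)

lemma poly_funs_sum:
  assumes "\<And>i. i \<in> A \<Longrightarrow> f i \<in> poly_funs d"
  shows "(\<lambda>z. \<Sum>i\<in>A. f i z) \<in> poly_funs d"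
proof -
  have "sum f A \<in> poly_funs d"
    using assms fps_fun.span_sum[of A f] by (simp add: poly_funs_def)
  moreover have "sum f A = (\<lambda>z. \<Sum>i\<in>A. f i z)"
    by (induction A rule: infinite_finite_induct) (auto simp: fun_eq_iff)
  ultimately show ?thesis by simp
qed

lemma poly_funs_mult:
  assumes "f \<in> poly_funs d" "g \<in> poly_funs e"
  shows "(\<lambda>z. f z * g z) \<in> poly_funs (d + e)"
proof -
  have mono: "(\<lambda>z. monomial_fun \<gamma> z * g z) \<in> poly_funs (d + e)"
    if \<gamma>: "\<gamma> \<in> exponents_le d" for \<gamma>
    using assms(2) unfolding poly_funs_def[of e]
  proof (induction rule: fps_fun.span_induct_alt)
    case base
    then show ?case using fps_fun.span_zero by (simp add: poly_funs_def zero_fun_def)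
  next
    case (step c h k)
    then obtain \<delta> where \<delta>: "\<delta> \<in> exponents_le e" "h = monomial_fun \<delta>" by auto
    have "monomial_fun (\<lambda>c. \<gamma> c + \<delta> c) \<in> poly_funs (d + e)"
      using \<gamma> \<delta>(1) by (auto simp: poly_funs_def exponents_le_def intro!: fps_fun.span_base add_mono)
    then have "(\<lambda>z. fps_const c * monomial_fun (\<lambda>c. \<gamma> c + \<delta> c) z) \<in> poly_funs (d + e)"
      using fps_fun.span_scale by (simp add: poly_funs_def)
    from poly_funs_add[OF this step(2)] show ?case
      by (simp add: \<delta>(2) monomial_fun_def power_add prod.distrib algebra_simps)
  qed
  show ?thesis
    using assms(1) unfolding poly_funs_def[of d]
  proof (induction rule: fps_fun.span_induct_alt)
    case base
    then show ?case using fps_fun.span_zero by (simp add: poly_funs_def zero_fun_def)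
  next
    case (step c h k)
    then obtain \<delta> where \<delta>: "\<delta> \<in> exponents_le d" "h = monomial_fun \<delta>" by auto
    have "(\<lambda>z. fps_const c * (monomial_fun \<delta> z * g z)) \<in> poly_funs (d + e)"
      using mono[OF \<delta>(1)] fps_fun.span_scale by (simp add: poly_funs_def)
    from poly_funs_add[OF this step(2)] show ?case
      by (simp add: \<delta>(2) algebra_simps)
  qed
qed

lemma poly_funs_const: "(\<lambda>z. fps_const a) \<in> poly_funs d"
proof -
  have "monomial_fun (\<lambda>_. 0) \<in> poly_funs d"
    by (auto simp: poly_funs_def exponents_le_def intro!: fps_fun.span_base)
  then have "(\<lambda>z. fps_const a * monomial_fun (\<lambda>_. 0) z) \<in> poly_funs d"
    using fps_fun.span_scale by (simp add: poly_funs_def)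
  then show ?thesis by (simp add: monomial_fun_def)
qed

lemma poly_funs_coord: "(\<lambda>z :: 'c::finite \<Rightarrow> 'a::field fps. z c) \<in> poly_funs 1"
proof -
  define \<delta> where "\<delta> = (\<lambda>c'. if c' = c then 1 else 0 :: nat)"
  have "monomial_fun \<delta> z = z c" for z :: "'c \<Rightarrow> 'a fps"
  proof -
    have "monomial_fun \<delta> z = (\<Prod>c'\<in>UNIV. if c' = c then z c' else 1)"
      unfolding monomial_fun_def by (intro prod.cong) (auto simp: \<delta>_def)
    then show ?thesis by simp
  qed
  then have "(\<lambda>z :: 'c \<Rightarrow> 'a fps. z c) = monomial_fun \<delta>" by auto
  moreover have "\<delta> \<in> exponents_le 1" by (simp add: exponents_le_def \<delta>_def)
  ultimately show ?thesis by (auto simp: poly_funs_def intro!: fps_fun.span_base)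
qed

lemma poly_funs_power:
  assumes "f \<in> poly_funs d"
  shows "(\<lambda>z. f z ^ k) \<in> poly_funs (k * d)"
proof (induction k)
  case 0
  then show ?case using poly_funs_const[of 1] by simp
next
  case (Suc k)
  then show ?case using poly_funs_mult[OF assms Suc] by simp
qed

lemma poly_funs_prod:
  assumes "finite A" "\<And>i. i \<in> A \<Longrightarrow> f i \<in> poly_funs (d i)"
  shows "(\<lambda>z. \<Prod>i\<in>A. f i z) \<in> poly_funs (\<Sum>i\<in>A. d i)"
  using assms
proof (induction A rule: finite_induct)
  case empty
  then show ?case using poly_funs_const[of 1] by simp
next
  case (insert x A)
  then show ?case using poly_funs_mult[of "f x" "d x"] by simp
qed

lemma poly_funs_mono:
  assumes "f \<in> poly_funs d" "d \<le> e"
  shows "f \<in> poly_funs e"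
  using poly_funs_mult[OF assms(1) poly_funs_const[of 1 "e - d"]] assms(2) by simp

text \<open>The degree bound makes independence provable from orders of series: for two or more
  series no natural weights separate all exponent vectors, but a finite box of them can be
  separated.\<close>

definition alg_indep_upto :: "nat \<Rightarrow> ('n::finite \<Rightarrow> 'a::field fps) \<Rightarrow> bool" where
  "alg_indep_upto D y \<longleftrightarrow>
     (\<forall>q. (\<exists>\<alpha>\<in>exponents_le D. q \<alpha> \<noteq> 0) \<longrightarrow>
       (\<Sum>\<alpha>\<in>exponents_le D. fps_const (q \<alpha>) * monomial_fun \<alpha> y) \<noteq> 0)"

text \<open>
  The \<open>n\<close> functions \<open>p j\<close> and one further coordinate are \<open>n + 1\<close> polynomials in \<open>n\<close> variables,
  so they satisfy a polynomial relation, of a degree that dimension counting bounds by \<open>D\<close>.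
  On the fibre this relation becomes a nonzero polynomial equation for that coordinate.
\<close>

lemma finite_fibre_of_alg_indep:
  fixes p :: "'c::finite \<Rightarrow> ('c \<Rightarrow> 'a::field fps) \<Rightarrow> 'a fps"
  assumes p: "\<And>j. p j \<in> poly_funs d"
    and D: "(d * CARD('c) + 1) ^ CARD('c) \<le> D"
    and y: "alg_indep_upto D y"
  shows "finite {z. \<forall>j. p j z = y j}"
proof -
  define n where "n = CARD('c)"
  define E :: "('c \<Rightarrow> nat) set" where "E = exponents_le D"
  \<comment> \<open>In each variable, the powers of the \<open>p j\<close> contribute degree at most
    \<open>d * n * D\<close>, and the power of the extra coordinate at most
    \<open>D\<close>.\<close>
  define M where "M = (d * n + 1) * D"
  have finE: "finite E" by (simp add: E_def finite_exponents_le)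
  have fin_coord: "finite {z c |z. \<forall>j. p j z = y j}" for c
  proof -
    define v where "v = (\<lambda>(\<alpha>, \<beta>::nat) z. monomial_fun \<alpha> (\<lambda>j. p j z) * z c ^ \<beta>)"
    define I where "I = E \<times> {..D}"
    define B :: "(('c \<Rightarrow> 'a fps) \<Rightarrow> 'a fps) set" where "B = monomial_fun ` exponents_le M"
    have "v i \<in> fps_fun.span B" if "i \<in> I" for i
    proof -
      from that obtain \<alpha> \<beta> where i: "i = (\<alpha>, \<beta>)" "\<alpha> \<in> E" "\<beta> \<le> D" by (auto simp: I_def)
      have "(\<lambda>z. monomial_fun \<alpha> (\<lambda>j. p j z)) \<in> poly_funs (\<Sum>j\<in>UNIV. \<alpha> j * d)"
        unfolding monomial_fun_def by (intro poly_funs_prod poly_funs_power p) auto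
      moreover have "(\<lambda>z. z c ^ \<beta>) \<in> poly_funs (\<beta> * 1)"
        by (intro poly_funs_power poly_funs_coord)
      ultimately have "v i \<in> poly_funs ((\<Sum>j\<in>UNIV. \<alpha> j * d) + \<beta> * 1)"
        unfolding i v_def prod.case by (rule poly_funs_mult)
      moreover have "(\<Sum>j\<in>UNIV. \<alpha> j * d) \<le> (\<Sum>j\<in>(UNIV::'c set). D * d)"
        using i(2) by (intro sum_mono mult_right_mono) (auto simp: E_def exponents_le_def)
      then have "(\<Sum>j\<in>UNIV. \<alpha> j * d) + \<beta> * 1 \<le> M"
        using i(3) by (simp add: M_def n_def algebra_simps)
      ultimately have "v i \<in> poly_funs M" by (rule poly_funs_mono)
      then show ?thesis by (simp add: poly_funs_def B_def)
    qed
    then have "v ` I \<subseteq> fps_fun.span B" by blast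
    moreover have "finite I" "finite B"
      by (simp_all add: I_def B_def finE finite_exponents_le)
    moreover have "card B < card I"
    proof -
      \<comment> \<open>There are \<open>(D + 1) ^ (n + 1)\<close> products against at most
        \<open>(M + 1) ^ n\<close> monomials. The hypothesis on \<open>D\<close> bounds the surplus
        \<open>(d * n + 1) ^ n\<close> by \<open>D\<close>, which the one extra factor
        \<open>D + 1\<close> beats.\<close>
      have "card B \<le> (M + 1) ^ n"
        unfolding B_def n_def card_exponents_le[symmetric]
        by (intro card_image_le finite_exponents_le)
      also have "\<dots> \<le> ((d * n + 1) * (D + 1)) ^ n"
        by (intro power_mono) (auto simp: M_def)
      also have "\<dots> = (d * n + 1) ^ n * (D + 1) ^ n"
        by (rule power_mult_distrib)
      also have "\<dots> \<le> D * (D + 1) ^ n"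
        using D by (intro mult_right_mono) (auto simp: n_def)
      also have "\<dots> < (D + 1) ^ n * (D + 1)"
        by simp
      also have "\<dots> = card I"
        by (simp add: I_def E_def card_cartesian_product card_exponents_le n_def)
      finally show ?thesis .
    qed
    ultimately obtain q where q: "\<exists>i\<in>I. q i \<noteq> 0"
      "(\<Sum>i\<in>I. (\<lambda>z. fps_const (q i) * v i z)) = 0"
      using fps_fun.family_dependent_of_card[of I B v] by blast
    \<comment> \<open>With the values of \<open>p\<close> fixed to \<open>y\<close> and terms
      grouped by powers of the coordinate, the relation becomes a one-variable polynomial over the
      series ring. That ring is an integral domain, so a nonzero \<open>R\<close> has finitely many
      roots.\<close>
    define r where "r = (\<lambda>\<beta>. \<Sum>\<alpha>\<in>E. fps_const (q (\<alpha>, \<beta>)) * monomial_fun \<alpha> y)"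
    define R where "R = (\<Sum>\<beta>\<le>D. monom (r \<beta>) \<beta>)"
    have "R \<noteq> 0"
    proof -
      obtain \<alpha> \<beta> where ab: "\<alpha> \<in> E" "\<beta> \<le> D" "q (\<alpha>, \<beta>) \<noteq> 0" using q(1) by (auto simp: I_def)
      then have "r \<beta> \<noteq> 0"
        using y[unfolded alg_indep_upto_def, rule_format, of "\<lambda>\<alpha>. q (\<alpha>, \<beta>)"]
        by (auto simp: E_def r_def)
      moreover have "coeff R \<beta> = r \<beta>"
        using ab(2) by (simp add: R_def coeff_sum)
      ultimately show ?thesis by auto
    qed
    moreover have "poly R (z c) = 0" if z: "\<forall>j. p j z = y j" for z
    proof -
      have "0 = (\<Sum>i\<in>I. (\<lambda>z. fps_const (q i) * v i z)) z"
        by (simp add: q(2))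
      also have "\<dots> = (\<Sum>i\<in>I. fps_const (q i) * v i z)"
        by (induction I rule: infinite_finite_induct) auto
      also have "\<dots> = (\<Sum>\<alpha>\<in>E. \<Sum>\<beta>\<le>D. fps_const (q (\<alpha>, \<beta>)) * v (\<alpha>, \<beta>) z)"
        unfolding I_def by (subst sum.cartesian_product) (simp add: case_prod_beta)
      also have "\<dots> = (\<Sum>\<beta>\<le>D. \<Sum>\<alpha>\<in>E. fps_const (q (\<alpha>, \<beta>)) * v (\<alpha>, \<beta>) z)"
        by (rule sum.swap)
      also have "\<dots> = (\<Sum>\<beta>\<le>D. r \<beta> * z c ^ \<beta>)"
        using z by (simp add: v_def r_def sum_distrib_right mult.assoc)
      also have "\<dots> = poly R (z c)"
        by (simp add: R_def poly_sum poly_monom)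
      finally show ?thesis by simp
    qed
    ultimately show ?thesis
      by (intro finite_subset[OF _ poly_roots_finite[of R]]) auto
  qed
  have "{z. \<forall>j. p j z = y j} \<subseteq> PiE UNIV (\<lambda>c. {z c |z. \<forall>j. p j z = y j})"
    by auto
  then show ?thesis
    by (rule finite_subset) (intro finite_PiE fin_coord finite)
qed

subsection \<open>Power series of independent orders\<close>

text \<open>The nonzero term of least order is unique, so nothing cancels its leading
  coefficient.\<close>

lemma sum_fps_nonzero_of_inj_subdegree:
  fixes f :: "'i \<Rightarrow> 'a::field fps"
  assumes "finite A" "inj_on s A" "\<exists>i\<in>A. f i \<noteq> 0"
    and s: "\<And>i. i \<in> A \<Longrightarrow> f i \<noteq> 0 \<Longrightarrow> subdegree (f i) = s i"
  shows "sum f A \<noteq> 0"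
proof -
  define A' where "A' = {i\<in>A. f i \<noteq> 0}"
  have "finite (s ` A')" "s ` A' \<noteq> {}" using assms(1,3) by (auto simp: A'_def)
  then have "Min (s ` A') \<in> s ` A'" by (rule Min_in)
  then obtain i where i: "i \<in> A'" "s i = Min (s ` A')" by (elim imageE) simp
  have min: "s i \<le> s k" if "k \<in> A'" for k
    using that i(2) \<open>finite (s ` A')\<close> by simp
  have "fps_nth (sum f A) (s i) = (\<Sum>k\<in>A. fps_nth (f k) (s i))"
    by (simp add: fps_sum_nth)
  also have "\<dots> = (\<Sum>k\<in>{i}. fps_nth (f k) (s i))"
  proof (intro sum.mono_neutral_right ballI)
    fix k assume k: "k \<in> A - {i}"
    show "fps_nth (f k) (s i) = 0"
    proof (cases "f k = 0")
      case False
      with k have "k \<in> A'" by (simp add: A'_def)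
      moreover have "s k \<noteq> s i"
        using k i(1) assms(2) by (auto simp: A'_def inj_on_def)
      ultimately have "s i < subdegree (f k)"
        using min[of k] s[of k] by (auto simp: A'_def)
      then show ?thesis by (rule nth_less_subdegree_zero)
    qed simp
  qed (use assms(1) i(1) in \<open>auto simp: A'_def\<close>)
  also have "\<dots> \<noteq> 0"
    using i(1) s[of i] nth_subdegree_nonzero[of "f i"] by (auto simp: A'_def)
  finally show ?thesis by auto
qed

lemma subdegree_prod_power:
  fixes y :: "'n \<Rightarrow> 'a::field fps"
  assumes "finite A" "\<And>j. j \<in> A \<Longrightarrow> y j \<noteq> 0"
  shows "subdegree (\<Prod>j\<in>A. y j ^ \<alpha> j) = (\<Sum>j\<in>A. \<alpha> j * subdegree (y j))"
  using assms
proof (induction A rule: finite_induct)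
  case (insert x A)
  then have "(\<Prod>j\<in>A. y j ^ \<alpha> j) \<noteq> 0" by simp
  with insert show ?case by simp
qed simp

text \<open>The order of a monomial in \<open>y\<close> is the weighted sum of its exponents, so the
  terms of a relation have distinct orders and cannot cancel.\<close>

lemma alg_indep_upto_of_inj_subdegree:
  fixes y :: "'n::finite \<Rightarrow> 'a::field fps"
  assumes y: "\<And>j. y j \<noteq> 0" "\<And>j. subdegree (y j) = e j"
    and inj: "inj_on (\<lambda>\<alpha>. \<Sum>j\<in>UNIV. \<alpha> j * e j) (exponents_le D)"
  shows "alg_indep_upto D y"
  unfolding alg_indep_upto_def
proof (intro allI impI)
  fix q :: "('n \<Rightarrow> nat) \<Rightarrow> 'a"
  assume q: "\<exists>\<alpha>\<in>exponents_le D. q \<alpha> \<noteq> 0"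
  have nz: "monomial_fun \<alpha> y \<noteq> 0" for \<alpha>
    using y by (simp add: monomial_fun_def)
  show "(\<Sum>\<alpha>\<in>exponents_le D. fps_const (q \<alpha>) * monomial_fun \<alpha> y) \<noteq> 0"
  proof (rule sum_fps_nonzero_of_inj_subdegree[OF finite_exponents_le inj])
    show "\<exists>\<alpha>\<in>exponents_le D. fps_const (q \<alpha>) * monomial_fun \<alpha> y \<noteq> 0"
      using q nz by auto
    show "subdegree (fps_const (q \<alpha>) * monomial_fun \<alpha> y) = (\<Sum>j\<in>UNIV. \<alpha> j * e j)"
      if "fps_const (q \<alpha>) * monomial_fun \<alpha> y \<noteq> 0" for \<alpha>
      using that y by (simp add: monomial_fun_def subdegree_prod_power)
  qed
qed

section \<open>Weights that separate bounded exponent vectors\<close>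

lemma exists_inj_weights_on:
  assumes "finite A"
  shows "\<exists>w. inj_on (\<lambda>\<alpha>. \<Sum>j\<in>A. \<alpha> j * w j) (PiE A (\<lambda>_. {..D::nat}))"
  using assms
proof (induction A rule: finite_induct)
  case empty
  then show ?case by (auto simp: inj_on_def)
next
  case (insert x A)
  then obtain w where w: "inj_on (\<lambda>\<alpha>. \<Sum>j\<in>A. \<alpha> j * w j) (PiE A (\<lambda>_. {..D}))" by blast
  \<comment> \<open>Expansion in base \<open>D + 1\<close>: the exponent of \<open>x\<close> becomes
    the lowest digit, and the old weighted sum moves up one place.\<close>
  define w' where "w' = (\<lambda>j. if j = x then 1 else (D + 1) * w j)"
  have sum: "(\<Sum>j\<in>insert x A. \<alpha> j * w' j) = \<alpha> x + (D + 1) * (\<Sum>j\<in>A. \<alpha> j * w j)" for \<alpha>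
  proof -
    have "(\<Sum>j\<in>A. \<alpha> j * w' j) = (\<Sum>j\<in>A. (D + 1) * (\<alpha> j * w j))"
      using insert(2) by (intro sum.cong) (auto simp: w'_def algebra_simps)
    then show ?thesis
      using insert(1,2) by (simp add: w'_def sum_distrib_left)
  qed
  show ?case
  proof (intro exI inj_onI)
    fix \<alpha> \<beta>
    assume \<alpha>: "\<alpha> \<in> PiE (insert x A) (\<lambda>_. {..D})" and \<beta>: "\<beta> \<in> PiE (insert x A) (\<lambda>_. {..D})"
      and eq: "(\<Sum>j\<in>insert x A. \<alpha> j * w' j) = (\<Sum>j\<in>insert x A. \<beta> j * w' j)"
    have le: "\<alpha> x < D + 1" "\<beta> x < D + 1"
      using \<alpha> \<beta> by (auto simp: PiE_iff less_Suc_eq_le)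
    define S where "S = (\<lambda>\<alpha>. \<Sum>j\<in>A. \<alpha> j * w j)"
    have eqS: "\<alpha> x + (D + 1) * S \<alpha> = \<beta> x + (D + 1) * S \<beta>"
      using eq unfolding sum S_def .
    have "(\<alpha> x + (D + 1) * S \<alpha>) mod (D + 1) = \<alpha> x" "(\<beta> x + (D + 1) * S \<beta>) mod (D + 1) = \<beta> x"
      unfolding mod_mult_self2 using le by (simp_all only: mod_less)
    with eqS have x: "\<alpha> x = \<beta> x" by (simp only:)
    with eqS have "S \<alpha> = S \<beta>" by (simp del: mult_Suc)
    \<comment> \<open>Members of \<open>PiE A\<close> are \<open>undefined\<close> outside
      \<open>A\<close>, so injectivity for \<open>w\<close> applies to the restrictions.\<close>
    then have "S (restrict \<alpha> A) = S (restrict \<beta> A)"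
      by (simp add: S_def)
    moreover have "restrict \<alpha> A \<in> PiE A (\<lambda>_. {..D})" "restrict \<beta> A \<in> PiE A (\<lambda>_. {..D})"
      using \<alpha> \<beta> by (auto simp: PiE_iff)
    ultimately have "restrict \<alpha> A = restrict \<beta> A"
      unfolding S_def by (rule inj_onD[OF w])
    then have "\<alpha> j = \<beta> j" if "j \<in> A" for j
      using that by (auto dest: fun_cong[of _ _ j])
    with x show "\<alpha> = \<beta>"
      using \<alpha> \<beta> by (intro PiE_ext[of _ "insert x A"]) auto
  qed
qed

text \<open>Adding \<open>N\<close> to all weights changes each weighted sum by a multiple of
  \<open>N\<close>, so reduction modulo a large \<open>N\<close> recovers the old sum. The range
  keeps every prescribed order below \<open>2 * N\<close>, where quadratic terms begin.\<close>

lemma exists_inj_weights_in_octave: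
  "\<exists>N (e :: 'n::finite \<Rightarrow> nat).
     inj_on (\<lambda>\<alpha>. \<Sum>j\<in>UNIV. \<alpha> j * e j) (exponents_le D) \<and> (\<forall>j. N \<le> e j \<and> e j < 2 * N)"
proof -
  obtain w :: "'n \<Rightarrow> nat" where w: "inj_on (\<lambda>\<alpha>. \<Sum>j\<in>UNIV. \<alpha> j * w j) (exponents_le D)"
    using exists_inj_weights_on[of "UNIV :: 'n set" D] by (auto simp: exponents_le_eq_PiE)
  \<comment> \<open>The factor \<open>D + 1\<close> puts \<open>N\<close> above all old weighted
    sums in the box, and above each \<open>w j\<close> even when \<open>D = 0\<close>.\<close>
  define N where "N = (D + 1) * (\<Sum>j\<in>UNIV. w j) + 1"
  define e where "e = (\<lambda>j. N + w j)"
  have wN: "w j < N" for j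
    using member_le_sum[of j UNIV w] by (simp add: N_def)
  have mod: "(\<Sum>j\<in>UNIV. \<alpha> j * e j) mod N = (\<Sum>j\<in>UNIV. \<alpha> j * w j)" if "\<alpha> \<in> exponents_le D" for \<alpha>
  proof -
    have "(\<Sum>j\<in>UNIV. \<alpha> j * w j) \<le> (\<Sum>j\<in>UNIV. D * w j)"
      using that by (intro sum_mono mult_right_mono) (auto simp: exponents_le_def)
    then have "(\<Sum>j\<in>UNIV. \<alpha> j * w j) < N"
      by (simp add: N_def sum_distrib_left[symmetric])
    moreover have "(\<Sum>j\<in>UNIV. \<alpha> j * e j) = (\<Sum>j\<in>UNIV. \<alpha> j * w j) + N * (\<Sum>j\<in>UNIV. \<alpha> j)"
      by (simp add: e_def sum.distrib sum_distrib_left algebra_simps)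
    ultimately show ?thesis by simp
  qed
  have "inj_on (\<lambda>\<alpha>. \<Sum>j\<in>UNIV. \<alpha> j * e j) (exponents_le D)"
  proof (rule inj_onI)
    fix \<alpha> \<beta> :: "'n \<Rightarrow> nat"
    assume \<alpha>\<beta>: "\<alpha> \<in> exponents_le D" "\<beta> \<in> exponents_le D"
      and "(\<Sum>j\<in>UNIV. \<alpha> j * e j) = (\<Sum>j\<in>UNIV. \<beta> j * e j)"
    then have "(\<Sum>j\<in>UNIV. \<alpha> j * w j) = (\<Sum>j\<in>UNIV. \<beta> j * w j)"
      using mod[of \<alpha>] mod[of \<beta>] by simp
    then show "\<alpha> = \<beta>" using inj_onD[OF w] \<alpha>\<beta> by blast
  qed
  with wN show ?thesis
    by (intro exI[of _ N] exI[of _ e]) (auto simp: e_def)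
qed

subsection \<open>The trilinear form of a tensor\<close>

text \<open>At rows \<open>i\<close>, \<open>j\<close>, \<open>k\<close> of a matrix over the series
  ring this is the \<open>(i, j, k)\<close> entry of the congruence action.\<close>

definition tensor_form ::
    "('a::field, 'm::finite) tensor3 \<Rightarrow> ('m \<Rightarrow> 'a fps) \<Rightarrow> ('m \<Rightarrow> 'a fps) \<Rightarrow> ('m \<Rightarrow> 'a fps) \<Rightarrow> 'a fps" where
  "tensor_form T x y z = (\<Sum>a\<in>UNIV. \<Sum>b\<in>UNIV. \<Sum>c\<in>UNIV. fps_const (T $ a $ b $ c) * x a * y b * z c)"

definition unit_row :: "'m \<Rightarrow> 'm \<Rightarrow> 'a::field fps" where
  "unit_row i j = (if i = j then 1 else 0)"

lemma fps_const_sum: "fps_const (sum f A) = (\<Sum>i\<in>A. fps_const (f i))"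
  by (induction A rule: infinite_finite_induct) (simp_all flip: fps_const_add)

lemma tensor_form_add:
  "tensor_form T (\<lambda>a. x a + x' a) y z = tensor_form T x y z + tensor_form T x' y z"
  "tensor_form T x (\<lambda>a. y a + y' a) z = tensor_form T x y z + tensor_form T x y' z"
  "tensor_form T x y (\<lambda>a. z a + z' a) = tensor_form T x y z + tensor_form T x y z'"
  by (simp_all add: tensor_form_def algebra_simps sum.distrib)

lemma tensor_form_mult:
  "tensor_form T (\<lambda>a. r * x a) y z = r * tensor_form T x y z"
  "tensor_form T x (\<lambda>a. r * y a) z = r * tensor_form T x y z"
  "tensor_form T x y (\<lambda>a. r * z a) = r * tensor_form T x y z"
  by (simp_all add: tensor_form_def sum_distrib_left mult_ac)

lemma sum_mult_unit_row:
  fixes f :: "'m::finite \<Rightarrow> 'a::field fps"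
  shows "(\<Sum>a\<in>UNIV. f a * unit_row i a) = f i"
proof -
  have "(\<Sum>a\<in>UNIV. f a * unit_row i a) = (\<Sum>a\<in>UNIV. if i = a then f a else 0)"
    by (intro sum.cong) (auto simp: unit_row_def)
  then show ?thesis by simp
qed

lemma sum_mult_unit_row_mult:
  fixes f g :: "'m::finite \<Rightarrow> 'a::field fps"
  shows "(\<Sum>a\<in>UNIV. f a * unit_row i a * g a) = f i * g i"
  using sum_mult_unit_row[of "\<lambda>a. f a * g a" i] by (simp add: mult_ac)

lemma tensor_form_two_unit_rows:
  "tensor_form T x (unit_row j) (unit_row k) = (\<Sum>a\<in>UNIV. fps_const (T $ a $ j $ k) * x a)"
  "tensor_form T (unit_row i) y (unit_row k) = (\<Sum>b\<in>UNIV. fps_const (T $ i $ b $ k) * y b)"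
  "tensor_form T (unit_row i) (unit_row j) z = (\<Sum>c\<in>UNIV. fps_const (T $ i $ j $ c) * z c)"
proof -
  show "tensor_form T x (unit_row j) (unit_row k) = (\<Sum>a\<in>UNIV. fps_const (T $ a $ j $ k) * x a)"
    by (simp only: tensor_form_def sum_mult_unit_row)
  show "tensor_form T (unit_row i) y (unit_row k) = (\<Sum>b\<in>UNIV. fps_const (T $ i $ b $ k) * y b)"
    unfolding tensor_form_def sum_mult_unit_row
    by (subst sum.swap) (simp only: sum_mult_unit_row_mult)
  have "tensor_form T (unit_row i) (unit_row j) z =
      (\<Sum>a\<in>UNIV. \<Sum>c\<in>UNIV. \<Sum>b\<in>UNIV. fps_const (T $ a $ b $ c) * unit_row i a * unit_row j b * z c)"
    unfolding tensor_form_def by (intro sum.cong refl sum.swap)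
  also have "\<dots> = (\<Sum>a\<in>UNIV. \<Sum>c\<in>UNIV. fps_const (T $ a $ j $ c) * unit_row i a * z c)"
    by (simp only: sum_mult_unit_row_mult)
  also have "\<dots> = (\<Sum>c\<in>UNIV. fps_const (T $ i $ j $ c) * z c)"
    by (subst sum.swap) (simp only: sum_mult_unit_row_mult)
  finally show "tensor_form T (unit_row i) (unit_row j) z = (\<Sum>c\<in>UNIV. fps_const (T $ i $ j $ c) * z c)" .
qed

lemma tensor_form_sum:
  "tensor_form T (\<lambda>a. \<Sum>i\<in>A. f i a) y z = (\<Sum>i\<in>A. tensor_form T (f i) y z)"
  "tensor_form T x (\<lambda>a. \<Sum>i\<in>A. f i a) z = (\<Sum>i\<in>A. tensor_form T x (f i) z)"
  "tensor_form T x y (\<lambda>a. \<Sum>i\<in>A. f i a) = (\<Sum>i\<in>A. tensor_form T x y (f i))"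
  by (induction A rule: infinite_finite_induct; simp add: tensor_form_add;
      simp add: tensor_form_def)+

text \<open>By trilinearity, acting by \<open>A\<close> amounts to multiplying the rows by
  \<open>A\<close> on the right. If \<open>A\<close> stabilizes \<open>T\<close>, the form is
  therefore invariant under that multiplication.\<close>

lemma tensor_form_congruence:
  "tensor_form (congruence T A) x y z =
     tensor_form T (\<lambda>\<alpha>. \<Sum>a\<in>UNIV. x a * fps_const (A $ a $ \<alpha>))
       (\<lambda>\<beta>. \<Sum>b\<in>UNIV. y b * fps_const (A $ b $ \<beta>)) (\<lambda>\<gamma>. \<Sum>c\<in>UNIV. z c * fps_const (A $ c $ \<gamma>))"
proof -
  have "fps_const (congruence T A $ a $ b $ c) =
      tensor_form T (\<lambda>\<alpha>. fps_const (A $ a $ \<alpha>)) (\<lambda>\<beta>. fps_const (A $ b $ \<beta>)) (\<lambda>\<gamma>. fps_const (A $ c $ \<gamma>))"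
    for a b c
    by (simp add: congruence_def tensor_form_def fps_const_sum)
  then show ?thesis
    unfolding tensor_form_sum tensor_form_mult
    by (simp add: tensor_form_def[of "congruence T A"] sum_distrib_left mult_ac)
qed

text \<open>The three rows may coincide, so one variable can occur to the third power.\<close>

lemma tensor_form_poly_fun:
  fixes T :: "('a::field, 'm::finite) tensor3" and i j k :: 'm
  shows "(\<lambda>w. tensor_form T (\<lambda>a. w (i, a)) (\<lambda>a. w (j, a)) (\<lambda>a. w (k, a))) \<in> poly_funs 3"
proof -
  have *: "(\<lambda>w. fps_const c * w p * w q * w r) \<in> poly_funs 3" for c :: 'a and p q r :: "'m \<times> 'm"
    using poly_funs_mult[OF poly_funs_mult[OF poly_funs_mult[OF poly_funs_const[of c 0]
      poly_funs_coord[of p]] poly_funs_coord[of q]] poly_funs_coord[of r]]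
    by (simp add: numeral_3_eq_3)
  show ?thesis
    unfolding tensor_form_def by (intro poly_funs_sum) (rule *)
qed

text \<open>Product rule at the identity matrix: each Kronecker delta selects the row in which the
  perturbation \<open>h\<close> replaces an identity row.\<close>

lemma J1_mult_eq_linear_part:
  fixes h :: "'m::{finite,linorder} \<Rightarrow> 'm \<Rightarrow> 'a::field fps"
  shows "(\<Sum>c\<in>UNIV. fps_const (J1 T $ (i, j) $ c) * h (fst c) (snd c)) =
     tensor_form T (h i) (unit_row j) (unit_row first_index)
     + tensor_form T (unit_row i) (h j) (unit_row first_index)
     + tensor_form T (unit_row i) (unit_row j) (h first_index)"
proof -
  have delta: "(\<Sum>u\<in>UNIV. \<Sum>v\<in>UNIV. fps_const (kronecker u k) * f v * h u v) = (\<Sum>v\<in>UNIV. f v * h k v)"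
    for k :: 'm and f :: "'m \<Rightarrow> 'a fps"
  proof -
    have "(\<Sum>u\<in>UNIV. \<Sum>v\<in>UNIV. fps_const (kronecker u k) * f v * h u v) =
        (\<Sum>u\<in>UNIV. if u = k then \<Sum>v\<in>UNIV. f v * h u v else 0)"
      by (intro sum.cong) (auto simp: kronecker_def)
    then show ?thesis by simp
  qed
  have "(\<Sum>c\<in>UNIV. fps_const (J1 T $ (i, j) $ c) * h (fst c) (snd c)) =
      (\<Sum>u\<in>UNIV. \<Sum>v\<in>UNIV. fps_const (J1 T $ (i, j) $ (u, v)) * h u v)"
    by (simp add: sum.cartesian_product UNIV_Times_UNIV case_prod_beta)
  also have "\<dots> = (\<Sum>u\<in>UNIV. \<Sum>v\<in>UNIV.
        fps_const (kronecker u i) * fps_const (T $ v $ j $ first_index) * h u v)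
      + (\<Sum>u\<in>UNIV. \<Sum>v\<in>UNIV.
        fps_const (kronecker u j) * fps_const (T $ i $ v $ first_index) * h u v)
      + (\<Sum>u\<in>UNIV. \<Sum>v\<in>UNIV.
        fps_const (kronecker u first_index) * fps_const (T $ i $ j $ v) * h u v)"
    by (simp add: J1_def distrib_right sum.distrib flip: fps_const_add fps_const_mult)
  finally show ?thesis
    unfolding delta tensor_form_two_unit_rows .
qed

text \<open>
  The curve is chosen by inverting the linear part \<open>J\<^sub>1\<close>. Since all prescribed orders lie in
  \<open>[N, 2N)\<close>, the quadratic and cubic terms do not disturb them.
\<close>

lemma exists_curve_with_orders:
  fixes T :: "('a::field, 'm::{finite,linorder}) tensor3"
  assumes inv: "invertible (J1 T)" and e: "\<And>c. N \<le> e c \<and> e c < 2 * N"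
  shows "\<exists>h. (\<forall>i j. fps_nth (h i j) 0 = 0) \<and>
    (\<forall>i j. let y = tensor_form T (\<lambda>a. unit_row i a + h i a) (\<lambda>a. unit_row j a + h j a)
                     (\<lambda>a. unit_row first_index a + h first_index a)
                   - fps_const (T $ i $ j $ first_index)
            in y \<noteq> 0 \<and> subdegree y = e (i, j))"
proof -
  obtain B where B: "J1 T ** B = mat 1" using inv by (auto simp: invertible_def)
  \<comment> \<open>\<open>h\<close> will be the inverse of \<open>J1 T\<close> applied to the
    vector of powers \<open>fps_X ^ e c\<close>. Since \<open>N \<le> e c\<close>, a factor
    \<open>fps_X ^ N\<close> splits off and leaves \<open>g\<close>.\<close>
  define g where "g = (\<lambda>u v. \<Sum>c\<in>UNIV. fps_const (B $ (u, v) $ c) * fps_X ^ (e c - N))"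
  define h where "h = (\<lambda>u v. fps_X ^ N * g u v)"
  have h_eq: "h u v = (\<Sum>c\<in>UNIV. fps_const (B $ (u, v) $ c) * fps_X ^ e c)" for u v
  proof -
    have "fps_X ^ N * fps_X ^ (e c - N) = (fps_X ^ e c :: 'a fps)" for c
      using e[of c] by (simp flip: power_add)
    then show ?thesis
      by (simp add: h_def g_def sum_distrib_left mult.left_commute[of "fps_X ^ N"])
  qed
  have lin: "(\<Sum>c\<in>UNIV. fps_const (J1 T $ r $ c) * h (fst c) (snd c)) = fps_X ^ e r" for r
  proof -
    have "(\<Sum>c\<in>UNIV. fps_const (J1 T $ r $ c) * h (fst c) (snd c)) =
        (\<Sum>c\<in>UNIV. \<Sum>d\<in>UNIV. fps_const (J1 T $ r $ c * B $ c $ d) * fps_X ^ e d)"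
      unfolding h_eq prod.collapse sum_distrib_left fps_const_mult[symmetric] mult.assoc ..
    also have "\<dots> = (\<Sum>d\<in>UNIV. \<Sum>c\<in>UNIV. fps_const (J1 T $ r $ c * B $ c $ d) * fps_X ^ e d)"
      by (rule sum.swap)
    also have "\<dots> = (\<Sum>d\<in>UNIV. fps_const ((J1 T ** B) $ r $ d) * fps_X ^ e d)"
      by (simp add: matrix_matrix_mult_def fps_const_sum sum_distrib_right)
    also have "\<dots> = (\<Sum>d\<in>UNIV. if r = d then fps_X ^ e d else 0)"
      unfolding B by (intro sum.cong) (auto simp: mat_def)
    finally show ?thesis by simp
  qed
  have const: "fps_nth (h i j) 0 = 0" for i j
  proof -
    have "0 < N" using e[of "(i, j)"] by linarith
    then show ?thesis by (simp add: h_def)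
  qed
  have ord: "y \<noteq> 0 \<and> subdegree y = e (i, j)"
    if y: "y = tensor_form T (\<lambda>a. unit_row i a + h i a) (\<lambda>a. unit_row j a + h j a)
                 (\<lambda>a. unit_row first_index a + h first_index a)
               - fps_const (T $ i $ j $ first_index)" for y i j
  proof -
    let ?k = "first_index :: 'm"
    \<comment> \<open>The terms of degree two and three in \<open>h\<close>, divided by
      \<open>fps_X ^ (2 * N)\<close>; the cubic one retains a factor
      \<open>fps_X ^ N\<close>.\<close>
    define s where "s = tensor_form T (unit_row i) (g j) (g ?k) + tensor_form T (g i) (unit_row j) (g ?k)
      + tensor_form T (g i) (g j) (unit_row ?k) + fps_X ^ N * tensor_form T (g i) (g j) (g ?k)"
    have "tensor_form T (unit_row i) (unit_row j) (unit_row ?k) = fps_const (T $ i $ j $ ?k)"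
      by (simp only: tensor_form_two_unit_rows sum_mult_unit_row)
    then have "y = tensor_form T (h i) (unit_row j) (unit_row ?k) + tensor_form T (unit_row i) (h j) (unit_row ?k)
        + tensor_form T (unit_row i) (unit_row j) (h ?k) + fps_X ^ N * fps_X ^ N * s"
      unfolding y tensor_form_add h_def s_def tensor_form_mult by (simp add: algebra_simps)
    then have yn: "y = fps_X ^ e (i, j) + fps_X ^ (2 * N) * s"
      unfolding J1_mult_eq_linear_part[symmetric] lin mult_2 power_add .
    have "fps_nth y (e (i, j)) = 1"
      using e[of "(i, j)"] by (simp add: yn fps_X_power_mult_nth)
    moreover have "fps_nth y k = 0" if "k < e (i, j)" for k
      using e[of "(i, j)"] that by (simp add: yn fps_X_power_mult_nth)
    ultimately have "subdegree y = e (i, j)"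
      by (intro subdegreeI) auto
    with \<open>fps_nth y (e (i, j)) = 1\<close> show ?thesis by auto
  qed
  show ?thesis
    unfolding Let_def using const ord by blast
qed

theorem proposition3p3:
  fixes T :: "('a::field, 'm::{finite,linorder}) tensor3"
  assumes "invertible (J1 T)"
  shows "finite (stabilizer T)"
proof -
  define D where "D = (3 * CARD('m \<times> 'm) + 1) ^ CARD('m \<times> 'm)"
  obtain N and e :: "'m \<times> 'm \<Rightarrow> nat" where
    inj: "inj_on (\<lambda>\<alpha>. \<Sum>j\<in>UNIV. \<alpha> j * e j) (exponents_le D)"
    and e: "\<forall>c. N \<le> e c \<and> e c < 2 * N"
    using exists_inj_weights_in_octave[where 'n = "'m \<times> 'm" and D = D] by blast
  \<comment> \<open>Subtracting the value at the identity matrix leaves the series whose orders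
    along the curve are prescribed by \<open>e\<close>.\<close>
  define p where "p = (\<lambda>(i, j) w. tensor_form T (\<lambda>a. w (i, a)) (\<lambda>a. w (j, a)) (\<lambda>a. w (first_index, a))
    - fps_const (T $ i $ j $ first_index))"
  obtain h where h0: "\<forall>i j. fps_nth (h i j) 0 = 0"
    and h: "\<forall>i j. p (i, j) (\<lambda>(i, a). unit_row i a + h i a) \<noteq> 0 \<and>
      subdegree (p (i, j) (\<lambda>(i, a). unit_row i a + h i a)) = e (i, j)"
    using exists_curve_with_orders[OF assms, of N e] e unfolding p_def Let_def prod.case by blast
  define \<Phi> where "\<Phi> = (\<lambda>(i, a). unit_row i a + h i a)"
  define y where "y = (\<lambda>c. p c \<Phi>)"
  have y: "y c \<noteq> 0" "subdegree (y c) = e c" for c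
    using h by (cases c; simp add: y_def \<Phi>_def)+
  have "alg_indep_upto D y"
    using y inj by (rule alg_indep_upto_of_inj_subdegree)
  moreover have "p c \<in> poly_funs 3" for c
    using poly_funs_diff[OF tensor_form_poly_fun poly_funs_const]
    by (cases c) (simp add: p_def)
  ultimately have fin: "finite {z. \<forall>c. p c z = y c}"
    by (intro finite_fibre_of_alg_indep[where d = 3 and D = D]) (simp_all only: D_def order.refl)
  \<comment> \<open>\<open>M A\<close> is the matrix product of the curve \<Phi> with
    \<open>A\<close>; for stabilizing \<open>A\<close> it stays in the fibre of \<open>p\<close>
    through \<Phi>.\<close>
  define M where "M = (\<lambda>(A :: (('a, 'm) vec, 'm) vec) (i, \<alpha>). \<Sum>a\<in>UNIV. \<Phi> (i, a) * fps_const (A $ a $ \<alpha>))"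
  have "p c (M A) = y c" if "A \<in> stabilizer T" for A c
  proof -
    have "congruence T A = T" using that by (simp add: stabilizer_def)
    then show ?thesis
      using tensor_form_congruence[of T A] by (cases c) (simp add: y_def p_def M_def)
  qed
  then have "finite (M ` stabilizer T)"
    by (intro finite_subset[OF _ fin]) auto
  moreover have "inj M"
  proof (rule injI)
    fix A A' assume eq: "M A = M A'"
    \<comment> \<open>\<Phi> has the identity as constant term, so \<open>A\<close> can be read off
      from \<open>M A\<close>.\<close>
    have "fps_nth (M A (i, \<alpha>)) 0 = A $ i $ \<alpha>" for A i \<alpha>
    proof -
      have "fps_nth (M A (i, \<alpha>)) 0 = (\<Sum>a\<in>UNIV. if i = a then A $ a $ \<alpha> else 0)"
        unfolding M_def \<Phi>_def prod.case fps_sum_nth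
        by (intro sum.cong) (auto simp: unit_row_def h0)
      then show ?thesis by simp
    qed
    from this[of A] this[of A'] eq show "A = A'" by (simp add: vec_eq_iff)
  qed
  ultimately show ?thesis
    by (blast intro: finite_imageD inj_on_subset)
qed

end
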